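(* Let $f,g:\{0,1\}^n\to\{0,1\}$ be two Boolean functions. If there exists $c\in\{0,1\}^n$ such that $f(x)=g(x)$ for every $x\in\{0,1\}^n$ at Hamming distance at most $\mathrm{s}(f)+\mathrm{s}(g)$ from $c$, then $f=g$.
   Context: For $x\in\{0,1\}^n$ and $i\in[n]$, $x^i$ is $x$ with the $i$-th bit flipped. The sensitivity of $f$ at $x$ is $\mathrm{s}(f,x)=|\{i\in[n]: f(x)\ne f(x^i)\}|$ and $\mathrm{s}(f)=\max_{x}\mathrm{s}(f,x)$. *)

theory Defs
  imports Main
begin

(* The cube {0,1}^n is the set of Boolean lists of length n; coordinates are
   numbered 0, ..., n - 1.  A Boolean function on the cube is a HOL function on
   lists whose values outside cube n carry no meaning, so equality of two
   such functions means agreement on cube n. *)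

definition cube :: "nat \<Rightarrow> bool list set" where
  "cube n = {x. length x = n}"

definition flip :: "bool list \<Rightarrow> nat \<Rightarrow> bool list" where
  "flip x i = x[i := \<not> x ! i]"

definition hamming_dist :: "bool list \<Rightarrow> bool list \<Rightarrow> nat" where
  "hamming_dist x y = card {i. i < length x \<and> x ! i \<noteq> y ! i}"

definition sensitivity_at :: "(bool list \<Rightarrow> bool) \<Rightarrow> bool list \<Rightarrow> nat" where
  "sensitivity_at f x = card {i. i < length x \<and> f x \<noteq> f (flip x i)}"

definition sensitivity :: "nat \<Rightarrow> (bool list \<Rightarrow> bool) \<Rightarrow> nat" where
  "sensitivity n f = Max (sensitivity_at f ` cube n)"

lemma finite_cube: "finite (cube n)"
  using finite_lists_length_eq[of "UNIV :: bool set" n] by (simp add: cube_def)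

lemma cube_nonempty: "cube n \<noteq> {}"
  unfolding cube_def by (auto intro: exI[of _ "replicate n False"])

lemma flip_in_cube: "x \<in> cube n \<Longrightarrow> flip x i \<in> cube n"
  by (simp add: cube_def flip_def)

end

theory Submission
  imports Defs
begin

text \<open>Suppose \<open>f\<close> and \<open>g\<close> agree at every neighbour of \<open>x\<close> that is closer to \<open>c\<close>, but not
  at \<open>x\<close> itself. At each of these neighbours, whose number is the distance of \<open>x\<close> from \<open>c\<close>,
  one of \<open>f\<close> and \<open>g\<close> differs from its value at \<open>x\<close>, so this distance is at most the sum of
  the sensitivities. The theorem follows by induction on the distance from \<open>c\<close>.\<close>

lemma sensitivity_at_le_sensitivity:
  "x \<in> cube n \<Longrightarrow> sensitivity_at f x \<le> sensitivity n f"
  unfolding sensitivity_def by (simp add: finite_cube)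

lemma hamming_dist_flip_less:
  assumes "i < length x" "x ! i \<noteq> c ! i"
  shows "hamming_dist (flip x i) c < hamming_dist x c"
  unfolding hamming_dist_def
proof (rule psubset_card_mono)
  \<comment> \<open>The inclusion is strict since \<open>i\<close> drops out: negating a bit that
    differs from \<open>c ! i\<close> yields \<open>c ! i\<close>.\<close>
  show "{j. j < length (flip x i) \<and> flip x i ! j \<noteq> c ! j} \<subset> {j. j < length x \<and> x ! j \<noteq> c ! j}"
    using assms by (auto simp: flip_def nth_list_update split: if_splits)
qed simp

lemma hamming_dist_le_sensitivity_at:
  assumes "f x \<noteq> g x"
    and "\<And>i. i < length x \<Longrightarrow> x ! i \<noteq> c ! i \<Longrightarrow> f (flip x i) = g (flip x i)"
  shows "hamming_dist x c \<le> sensitivity_at f x + sensitivity_at g x"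
proof -
  let ?A = "\<lambda>h. {i. i < length x \<and> h x \<noteq> h (flip x i)}"
  \<comment> \<open>The common value of \<open>f\<close> and \<open>g\<close> at
    \<open>flip x i\<close> cannot equal both \<open>f x\<close> and \<open>g x\<close>.\<close>
  have "{i. i < length x \<and> x ! i \<noteq> c ! i} \<subseteq> ?A f \<union> ?A g"
    using assms by blast
  then have "hamming_dist x c \<le> card (?A f \<union> ?A g)"
    unfolding hamming_dist_def by (intro card_mono) auto
  also have "\<dots> \<le> card (?A f) + card (?A g)"
    by (rule card_Un_le)
  finally show ?thesis
    by (simp add: sensitivity_at_def)
qed

theorem theorem7:
  fixes n :: nat and f g :: "bool list \<Rightarrow> bool"
  assumes "\<exists>c \<in> cube n. \<forall>x \<in> cube n.
             hamming_dist x c \<le> sensitivity n f + sensitivity n g \<longrightarrow> f x = g x"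
  shows "\<forall>x \<in> cube n. f x = g x"
proof
  obtain c where c: "\<And>x. x \<in> cube n \<Longrightarrow>
      hamming_dist x c \<le> sensitivity n f + sensitivity n g \<Longrightarrow> f x = g x"
    using assms by blast
  fix x assume "x \<in> cube n"
  then show "f x = g x"
  \<comment> \<open>No base case is split off: at every distance, a disagreement at \<open>x\<close>
    forces \<open>x\<close> into the ball around \<open>c\<close> where \<open>f\<close> and
    \<open>g\<close> agree.\<close>
  proof (induction "hamming_dist x c" arbitrary: x rule: less_induct)
    case less
    show ?case
    proof (rule ccontr)
      assume ne: "f x \<noteq> g x"
      have "f (flip x i) = g (flip x i)" if "i < length x" "x ! i \<noteq> c ! i" for i
        using less.hyps[OF hamming_dist_flip_less[OF that]] flip_in_cube[OF less.prems] by blast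
      then have "hamming_dist x c \<le> sensitivity_at f x + sensitivity_at g x"
        using ne by (intro hamming_dist_le_sensitivity_at)
      also have "\<dots> \<le> sensitivity n f + sensitivity n g"
        by (intro add_mono sensitivity_at_le_sensitivity less.prems)
      finally show False
        using c less.prems ne by blast
    qed
  qed
qed

end
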